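(* Let $K$ be an arbitrary field and let $A$ be the free metabelian anticommutative algebra over $K$ with free generators $x_1,x_2$ (rank $n=2$). Then every automorphism of $A$ is linear, i.e. $\mathrm{Aut}(A)$ coincides with the group of linear automorphisms of $A$; hence $\mathrm{Aut}(A)\simeq GL_2(K)$.
   Context: Algebras are nonassociative and without required unit. An algebra over $K$ is anticommutative if it satisfies the identity $x^2=0$, and metabelian if it satisfies the identity $(xy)(zt)=0$. The free metabelian anticommutative algebra on $x_1,x_2$ is the free algebra on these generators in the variety defined by these two identities. An automorphism $\phi$ of $A$ is linear if $\phi(x_1)$ and $\phi(x_2)$ are $K$-linear combinations of $x_1,x_2$. The group of linear automorphisms is identified with $GL_2(K)$. *)

theory Defs
  imports
    "HOL-Analysis.Determinants"
    "HOL-Algebra.Group"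
    "HOL-Library.Poly_Mapping"
begin

section \<open>Nonassociative algebras\<close>

definition anticommutative :: "('a \<Rightarrow> 'a \<Rightarrow> 'a::zero) \<Rightarrow> bool" where
  "anticommutative m \<longleftrightarrow> (\<forall>x. m x x = 0)"

definition metabelian :: "('a \<Rightarrow> 'a \<Rightarrow> 'a::zero) \<Rightarrow> bool" where
  "metabelian m \<longleftrightarrow> (\<forall>x y z t. m (m x y) (m z t) = 0)"

locale nonassoc_algebra = vector_space scale
  for scale :: "'k::field \<Rightarrow> 'a::ab_group_add \<Rightarrow> 'a" +
  fixes amult :: "'a \<Rightarrow> 'a \<Rightarrow> 'a"
  assumes amult_add_left: "amult (x + y) z = amult x z + amult y z"
    and amult_add_right: "amult x (y + z) = amult x y + amult x z"
    and amult_scale_left: "amult (scale c x) y = scale c (amult x y)"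
    and amult_scale_right: "amult x (scale c y) = scale c (amult x y)"
begin

definition ideal :: "'a set \<Rightarrow> bool" where
  "ideal I \<longleftrightarrow> subspace I \<and> (\<forall>a\<in>I. \<forall>b. amult a b \<in> I \<and> amult b a \<in> I)"

lemma ideal_hull: "ideal (ideal hull S)"
  by (rule hull_in) (auto simp: ideal_def intro!: subspace_Inter)

end

definition algebra_hom ::
  "('k::field \<Rightarrow> 'a::ab_group_add \<Rightarrow> 'a) \<Rightarrow> ('a \<Rightarrow> 'a \<Rightarrow> 'a) \<Rightarrow>
   ('k \<Rightarrow> 'b::ab_group_add \<Rightarrow> 'b) \<Rightarrow> ('b \<Rightarrow> 'b \<Rightarrow> 'b) \<Rightarrow> ('a \<Rightarrow> 'b) \<Rightarrow> bool" where
  "algebra_hom s m s' m' f \<longleftrightarrow>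
     Vector_Spaces.linear s s' f \<and> (\<forall>a b. f (m a b) = m' (f a) (f b))"

definition Aut :: "('k::field \<Rightarrow> 'a::ab_group_add \<Rightarrow> 'a) \<Rightarrow> ('a \<Rightarrow> 'a \<Rightarrow> 'a) \<Rightarrow> ('a \<Rightarrow> 'a) monoid" where
  "Aut s m = \<lparr>carrier = {f. algebra_hom s m s m f \<and> bij f}, mult = (\<circ>), one = id\<rparr>"


lemma (in nonassoc_algebra) group_Aut: "group (Aut scale amult)"
proof (rule groupI)
  have hom_iff: "algebra_hom scale amult scale amult f \<longleftrightarrow>
      (\<forall>a b. f (a + b) = f a + f b) \<and> (\<forall>c a. f (scale c a) = scale c (f a)) \<and>
      (\<forall>a b. f (amult a b) = amult (f a) (f b))" for f
    unfolding algebra_hom_def Vector_Spaces.linear_iff using vector_space_axioms by blast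
  show "f \<otimes>\<^bsub>Aut scale amult\<^esub> g \<in> carrier (Aut scale amult)"
    if "f \<in> carrier (Aut scale amult)" "g \<in> carrier (Aut scale amult)" for f g
    using that by (simp add: Aut_def hom_iff bij_comp)
  show "\<one>\<^bsub>Aut scale amult\<^esub> \<in> carrier (Aut scale amult)"
    by (simp add: Aut_def hom_iff)
  show "\<exists>g\<in>carrier (Aut scale amult). g \<otimes>\<^bsub>Aut scale amult\<^esub> f = \<one>\<^bsub>Aut scale amult\<^esub>"
    if "f \<in> carrier (Aut scale amult)" for f
  proof
    have f: "algebra_hom scale amult scale amult f" "bij f"
      using that by (simp_all add: Aut_def)
    have inv_eq: "inv_into UNIV f y = x" if "f x = y" for x y
      using that f(2) by (auto simp: bij_is_inj)
    have f_inv: "f (inv_into UNIV f y) = y" for y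
      using f(2) by (simp add: bij_is_surj surj_f_inv_f)
    have "algebra_hom scale amult scale amult (inv_into UNIV f)"
      using f(1) unfolding hom_iff by (auto intro!: inv_eq simp: f_inv)
    then show "inv_into UNIV f \<in> carrier (Aut scale amult)"
      using f(2) by (simp add: Aut_def bij_imp_bij_inv)
    show "inv_into UNIV f \<otimes>\<^bsub>Aut scale amult\<^esub> f = \<one>\<^bsub>Aut scale amult\<^esub>"
      using f(2) by (simp add: Aut_def bij_is_inj)
  qed
qed (auto simp: Aut_def)


section \<open>The free nonassociative algebra\<close>

datatype 'x magma = Leaf 'x | Node "'x magma" "'x magma"

lift_definition fna_scale :: "'k::field \<Rightarrow> ('x magma \<Rightarrow>\<^sub>0 'k) \<Rightarrow> ('x magma \<Rightarrow>\<^sub>0 'k)"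
  is "\<lambda>c p t. c * p t"
  by (erule rev_finite_subset) auto

text \<open>The bilinear extension of \<^const>\<open>Node\<close>: every tree that is not a generator splits uniquely,
  so each coefficient of a product is a single product of coefficients.\<close>

lift_definition fna_mult ::
  "('x magma \<Rightarrow>\<^sub>0 'k::field) \<Rightarrow> ('x magma \<Rightarrow>\<^sub>0 'k) \<Rightarrow> ('x magma \<Rightarrow>\<^sub>0 'k)"
  is "\<lambda>p q t. case t of Leaf _ \<Rightarrow> 0 | Node l r \<Rightarrow> p l * q r"
proof -
  fix p q :: "'x magma \<Rightarrow> 'k"
  assume fin: "finite {t. p t \<noteq> 0}" "finite {t. q t \<noteq> 0}"
  show "finite {t. (case t of Leaf _ \<Rightarrow> 0 | Node l r \<Rightarrow> p l * q r) \<noteq> 0}"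
  proof (rule finite_subset)
    show "{t. (case t of Leaf _ \<Rightarrow> 0 | Node l r \<Rightarrow> p l * q r) \<noteq> 0}
        \<subseteq> (\<lambda>(l, r). Node l r) ` ({t. p t \<noteq> 0} \<times> {t. q t \<noteq> 0})"
    proof
      fix t assume "t \<in> {t. (case t of Leaf _ \<Rightarrow> 0 | Node l r \<Rightarrow> p l * q r) \<noteq> 0}"
      then show "t \<in> (\<lambda>(l, r). Node l r) ` ({t. p t \<noteq> 0} \<times> {t. q t \<noteq> 0})"
        by (cases t) auto
    qed
  next
    show "finite ((\<lambda>(l, r). Node l r) ` ({t. p t \<noteq> 0} \<times> {t. q t \<noteq> 0}))"
      by (intro finite_imageI finite_cartesian_product fin)
  qed
qed

lemma lookup_fna_scale: "Poly_Mapping.lookup (fna_scale c p) t = c * Poly_Mapping.lookup p t"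
  by (simp add: fna_scale.rep_eq)

lemma lookup_fna_mult_Leaf: "Poly_Mapping.lookup (fna_mult p q) (Leaf x) = 0"
  by (simp add: fna_mult.rep_eq)

lemma lookup_fna_mult_Node: "Poly_Mapping.lookup (fna_mult p q) (Node l r) = Poly_Mapping.lookup p l * Poly_Mapping.lookup q r"
  by (simp add: fna_mult.rep_eq)

lemma fna_mult_single:
  "fna_mult (Poly_Mapping.single s a) (Poly_Mapping.single t b) = Poly_Mapping.single (Node s t) (a * b)"
proof (rule poly_mapping_eqI)
  fix u
  show "Poly_Mapping.lookup (fna_mult (Poly_Mapping.single s a) (Poly_Mapping.single t b)) u
      = Poly_Mapping.lookup (Poly_Mapping.single (Node s t) (a * b)) u"
    by (cases u) (auto simp: lookup_fna_mult_Leaf lookup_fna_mult_Node lookup_single when_def)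
qed

global_interpretation fna: nonassoc_algebra fna_scale fna_mult
proof unfold_locales
  fix x y z :: "'x magma \<Rightarrow>\<^sub>0 'k::field" and c :: 'k
  show "fna_mult (x + y) z = fna_mult x z + fna_mult y z"
    by (rule poly_mapping_eqI, rename_tac t, case_tac t)
       (simp_all add: lookup_fna_mult_Leaf lookup_fna_mult_Node lookup_add algebra_simps)
  show "fna_mult x (y + z) = fna_mult x y + fna_mult x z"
    by (rule poly_mapping_eqI, rename_tac t, case_tac t)
       (simp_all add: lookup_fna_mult_Leaf lookup_fna_mult_Node lookup_add algebra_simps)
  show "fna_mult (fna_scale c x) y = fna_scale c (fna_mult x y)"
    by (rule poly_mapping_eqI, rename_tac t, case_tac t)
       (simp_all add: lookup_fna_mult_Leaf lookup_fna_mult_Node lookup_fna_scale)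
  show "fna_mult x (fna_scale c y) = fna_scale c (fna_mult x y)"
    by (rule poly_mapping_eqI, rename_tac t, case_tac t)
       (simp_all add: lookup_fna_mult_Leaf lookup_fna_mult_Node lookup_fna_scale)
qed (auto intro!: poly_mapping_eqI simp: lookup_fna_scale lookup_add algebra_simps)


section \<open>The free metabelian anticommutative algebra\<close>

text \<open>The ideal of identities: it is generated by the values of \<open>x\<^sup>2\<close> and \<open>(xy)(zt)\<close> at all elements of
  the free nonassociative algebra. The free metabelian anticommutative algebra is the quotient by
  this ideal; the theorem \<open>free_ma_universal\<close> below is its universal property.\<close>

definition ma_ideal :: "('x magma \<Rightarrow>\<^sub>0 'k::field) set" where
  "ma_ideal = fna.ideal hull
     ({fna_mult a a | a. True} \<union> {fna_mult (fna_mult a b) (fna_mult c d) | a b c d. True})"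

lemma ma_ideal: "fna.ideal ma_ideal"
  unfolding ma_ideal_def by (rule fna.ideal_hull)

lemma ma_subspace: "fna.subspace ma_ideal"
  by (rule conjunct1[OF ma_ideal[unfolded fna.ideal_def]])

lemmas ma_ideal_add = fna.subspace_add[OF ma_subspace]
  and ma_ideal_diff = fna.subspace_diff[OF ma_subspace]
  and ma_ideal_neg = fna.subspace_neg[OF ma_subspace]
  and ma_ideal_scale = fna.subspace_scale[OF ma_subspace]
  and ma_ideal_0 = fna.subspace_0[OF ma_subspace]

lemma ma_ideal_mult:
  assumes "a \<in> ma_ideal"
  shows "fna_mult a b \<in> ma_ideal" "fna_mult b a \<in> ma_ideal"
  using bspec[OF conjunct2[OF ma_ideal[unfolded fna.ideal_def]] assms] by blast+

lemma ma_ideal_square: "fna_mult a a \<in> ma_ideal"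
  unfolding ma_ideal_def by (rule hull_inc) blast

lemma ma_ideal_metabelian: "fna_mult (fna_mult a b) (fna_mult c d) \<in> ma_ideal"
  unfolding ma_ideal_def by (rule hull_inc) blast

definition ma_cong :: "('x magma \<Rightarrow>\<^sub>0 'k::field) \<Rightarrow> ('x magma \<Rightarrow>\<^sub>0 'k) \<Rightarrow> bool" where
  "ma_cong a b \<longleftrightarrow> a - b \<in> ma_ideal"

lemma equivp_ma_cong: "equivp (ma_cong :: ('x magma \<Rightarrow>\<^sub>0 'k::field) \<Rightarrow> _)"
proof (rule equivpI)
  show "reflp (ma_cong :: ('x magma \<Rightarrow>\<^sub>0 'k) \<Rightarrow> _)"
    by (auto simp: reflp_def ma_cong_def ma_ideal_0)
  show "symp (ma_cong :: ('x magma \<Rightarrow>\<^sub>0 'k) \<Rightarrow> _)"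
    unfolding symp_def ma_cong_def using ma_ideal_neg by (metis minus_diff_eq)
  show "transp (ma_cong :: ('x magma \<Rightarrow>\<^sub>0 'k) \<Rightarrow> _)"
  proof (rule transpI)
    fix a b c :: "'x magma \<Rightarrow>\<^sub>0 'k"
    assume "ma_cong a b" "ma_cong b c"
    then have "(a - b) + (b - c) \<in> ma_ideal"
      unfolding ma_cong_def by (rule ma_ideal_add)
    then show "ma_cong a c" by (simp add: ma_cong_def)
  qed
qed

quotient_type (overloaded) ('k, 'x) free_ma = "'x magma \<Rightarrow>\<^sub>0 'k::field" / ma_cong
  by (rule equivp_ma_cong)

instantiation free_ma :: (field, type) ab_group_add
begin

lift_definition zero_free_ma :: "('a, 'b) free_ma" is 0 .

lift_definition plus_free_ma :: "('a, 'b) free_ma \<Rightarrow> ('a, 'b) free_ma \<Rightarrow> ('a, 'b) free_ma" is "(+)"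
proof -
  fix a b c d :: "'b magma \<Rightarrow>\<^sub>0 'a"
  assume "ma_cong a b" "ma_cong c d"
  then have "(a - b) + (c - d) \<in> ma_ideal"
    unfolding ma_cong_def by (rule ma_ideal_add)
  then show "ma_cong (a + c) (b + d)"
    by (simp add: ma_cong_def algebra_simps)
qed

lift_definition minus_free_ma :: "('a, 'b) free_ma \<Rightarrow> ('a, 'b) free_ma \<Rightarrow> ('a, 'b) free_ma" is "(-)"
proof -
  fix a b c d :: "'b magma \<Rightarrow>\<^sub>0 'a"
  assume "ma_cong a b" "ma_cong c d"
  then have "(a - b) - (c - d) \<in> ma_ideal"
    unfolding ma_cong_def by (rule ma_ideal_diff)
  then show "ma_cong (a - c) (b - d)"
    by (simp add: ma_cong_def algebra_simps)
qed

lift_definition uminus_free_ma :: "('a, 'b) free_ma \<Rightarrow> ('a, 'b) free_ma" is "uminus"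
proof -
  fix a b :: "'b magma \<Rightarrow>\<^sub>0 'a"
  assume "ma_cong a b"
  then have "- (a - b) \<in> ma_ideal"
    unfolding ma_cong_def by (rule ma_ideal_neg)
  then show "ma_cong (- a) (- b)"
    by (simp add: ma_cong_def)
qed

instance
  by standard (transfer, simp add: algebra_simps ma_cong_def ma_ideal_0)+

end

lift_definition ma_scale :: "'k::field \<Rightarrow> ('k, 'x) free_ma \<Rightarrow> ('k, 'x) free_ma" is fna_scale
proof -
  fix c :: 'k and a b :: "'x magma \<Rightarrow>\<^sub>0 'k"
  assume "ma_cong a b"
  then have "fna_scale c (a - b) \<in> ma_ideal"
    unfolding ma_cong_def by (rule ma_ideal_scale)
  then show "ma_cong (fna_scale c a) (fna_scale c b)"
    unfolding ma_cong_def fna.scale_right_diff_distrib .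
qed

lift_definition ma_mult :: "('k::field, 'x) free_ma \<Rightarrow> ('k, 'x) free_ma \<Rightarrow> ('k, 'x) free_ma"
  is fna_mult
proof -
  fix a b c d :: "'x magma \<Rightarrow>\<^sub>0 'k"
  assume "ma_cong a b" "ma_cong c d"
  then have "fna_mult (a - b) c \<in> ma_ideal" "fna_mult b (c - d) \<in> ma_ideal"
    unfolding ma_cong_def by (blast intro: ma_ideal_mult)+
  then have "fna_mult (a - b) c + fna_mult b (c - d) \<in> ma_ideal"
    by (rule ma_ideal_add)
  moreover have "fna_mult (a - b) c + fna_mult b (c - d) = fna_mult a c - fna_mult b d"
  proof -
    have "fna_mult (a - b) c + fna_mult b c = fna_mult a c"
      unfolding fna.amult_add_left[symmetric] by simp
    moreover have "fna_mult b (c - d) + fna_mult b d = fna_mult b c"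
      unfolding fna.amult_add_right[symmetric] by simp
    ultimately show ?thesis by (metis add.assoc add_diff_cancel_right')
  qed
  ultimately show "ma_cong (fna_mult a c) (fna_mult b d)"
    unfolding ma_cong_def by (rule subst[rotated])
qed

lift_definition ma_gen :: "'x \<Rightarrow> ('k::field, 'x) free_ma" is "\<lambda>x. Poly_Mapping.single (Leaf x) 1" .

global_interpretation ma: nonassoc_algebra ma_scale ma_mult
  by unfold_locales
     (transfer, simp add: ma_cong_def fna.amult_add_left fna.amult_add_right fna.amult_scale_left
        fna.amult_scale_right fna.scale_left_distrib fna.scale_right_distrib ma_ideal_0)+

lemma ma_anticommutative: "anticommutative ma_mult"
  unfolding anticommutative_def by (transfer, simp add: ma_cong_def ma_ideal_square)

lemma ma_metabelian: "metabelian ma_mult"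
  unfolding metabelian_def by (transfer, simp add: ma_cong_def ma_ideal_metabelian)

theorem free_ma_universal:
  fixes scale :: "'k::field \<Rightarrow> 'b::ab_group_add \<Rightarrow> 'b" and f :: "'x \<Rightarrow> 'b"
  assumes B: "nonassoc_algebra scale m" "anticommutative m" "metabelian m"
  shows "\<exists>!\<phi>. algebra_hom ma_scale ma_mult scale m \<phi> \<and> (\<forall>x. \<phi> (ma_gen x) = f x)"
proof -
  interpret B: nonassoc_algebra scale m by (rule B(1))
  interpret bil: vector_space_pair fna_scale scale by unfold_locales
  have m0 [simp]: "m 0 b = 0" "m b 0 = 0" for b
    using B.amult_scale_left[of 0 0 b] B.amult_scale_right[of b 0 0] by simp_all
  have m_sum_left: "m (sum g S) b = (\<Sum>s\<in>S. m (g s) b)" if "finite S" for g b and S :: "'x magma set"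
    using that by (induction S rule: finite_induct) (simp_all add: B.amult_add_left)
  have m_sum_right: "m b (sum g S) = (\<Sum>s\<in>S. m b (g s))" if "finite S" for g b and S :: "'x magma set"
    using that by (induction S rule: finite_induct) (simp_all add: B.amult_add_right)

  define ev where "ev = rec_magma f (\<lambda>_ _. m)"
  have ev_simps [simp]: "ev (Leaf x) = f x" "ev (Node l r) = m (ev l) (ev r)" for x l r
    by (simp_all add: ev_def)
  define \<Phi> where "\<Phi> p = (\<Sum>t\<in>Poly_Mapping.keys p. scale (Poly_Mapping.lookup p t) (ev t))" for p
  have \<Phi>_eq: "\<Phi> p = (\<Sum>t\<in>S. scale (Poly_Mapping.lookup p t) (ev t))" if "finite S" "Poly_Mapping.keys p \<subseteq> S" for p S
    unfolding \<Phi>_def using that by (intro sum.mono_neutral_left) (auto simp: in_keys_iff)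
  have \<Phi>_add: "\<Phi> (p + q) = \<Phi> p + \<Phi> q" for p q
  proof -
    have "Poly_Mapping.keys (p + q) \<subseteq> Poly_Mapping.keys p \<union> Poly_Mapping.keys q" by (rule keys_add)
    then show ?thesis
      by (simp add: \<Phi>_eq[of "Poly_Mapping.keys p \<union> Poly_Mapping.keys q"] lookup_add B.scale_left_distrib sum.distrib)
  qed
  have \<Phi>_scale: "\<Phi> (fna_scale c p) = scale c (\<Phi> p)" for c p
  proof -
    have "Poly_Mapping.keys (fna_scale c p) \<subseteq> Poly_Mapping.keys p" by (auto simp: in_keys_iff lookup_fna_scale)
    then show ?thesis
      by (simp add: \<Phi>_eq[of "Poly_Mapping.keys p"] lookup_fna_scale B.scale_sum_right)
  qed
  have \<Phi>_linear: "Vector_Spaces.linear fna_scale scale \<Phi>"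
    by unfold_locales (simp_all add: \<Phi>_add \<Phi>_scale)
  have \<Phi>_mult: "\<Phi> (fna_mult p q) = m (\<Phi> p) (\<Phi> q)" for p q
  proof -
    let ?N = "\<lambda>(l, r). Node l r"
    have sub: "Poly_Mapping.keys (fna_mult p q) \<subseteq> ?N ` (Poly_Mapping.keys p \<times> Poly_Mapping.keys q)"
    proof
      fix t assume "t \<in> Poly_Mapping.keys (fna_mult p q)"
      then show "t \<in> ?N ` (Poly_Mapping.keys p \<times> Poly_Mapping.keys q)"
        by (cases t) (auto simp: in_keys_iff lookup_fna_mult_Leaf lookup_fna_mult_Node image_iff)
    qed
    have "\<Phi> (fna_mult p q) = (\<Sum>t\<in>?N ` (Poly_Mapping.keys p \<times> Poly_Mapping.keys q). scale (Poly_Mapping.lookup (fna_mult p q) t) (ev t))"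
      by (rule \<Phi>_eq) (use sub in auto)
    also have "\<dots> = (\<Sum>(l, r)\<in>Poly_Mapping.keys p \<times> Poly_Mapping.keys q. scale (Poly_Mapping.lookup p l * Poly_Mapping.lookup q r) (m (ev l) (ev r)))"
      by (subst sum.reindex) (auto simp: inj_on_def lookup_fna_mult_Node case_prod_beta)
    also have "\<dots> = (\<Sum>l\<in>Poly_Mapping.keys p. \<Sum>r\<in>Poly_Mapping.keys q. scale (Poly_Mapping.lookup p l * Poly_Mapping.lookup q r) (m (ev l) (ev r)))"
      by (simp add: sum.cartesian_product)
    also have "\<dots> = m (\<Phi> p) (\<Phi> q)"
      by (subst sum.swap) (simp add: \<Phi>_def m_sum_left m_sum_right B.amult_scale_left
          B.amult_scale_right B.scale_sum_right mult.commute)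
    finally show ?thesis .
  qed
  have \<Phi>_single: "\<Phi> (Poly_Mapping.single t c) = scale c (ev t)" for t c
    using \<Phi>_eq[of "{t}" "Poly_Mapping.single t c"] by simp

  interpret \<Phi>: Vector_Spaces.linear fna_scale scale \<Phi> by (rule \<Phi>_linear)
  have "fna.ideal {p. \<Phi> p = 0}"
    unfolding fna.ideal_def using \<Phi>.subspace_kernel by (simp add: \<Phi>_mult)
  then have "ma_ideal \<subseteq> {p. \<Phi> p = 0}"
    unfolding ma_ideal_def
    by (rule hull_minimal[rotated])
       (use B(2,3) in \<open>auto simp: \<Phi>_mult anticommutative_def metabelian_def\<close>)
  then have \<Phi>_cong: "\<Phi> p = \<Phi> q" if "ma_cong p q" for p q
    using that \<Phi>.diff[of p q] by (auto simp: ma_cong_def)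

  define \<phi> where "\<phi> a = \<Phi> (rep_free_ma a)" for a
  have \<phi>_abs: "\<phi> (abs_free_ma p) = \<Phi> p" for p
    unfolding \<phi>_def by (rule \<Phi>_cong) (metis Quotient3_free_ma Quotient3_rep_abs equivp_def equivp_ma_cong)
  have "\<phi> (a + b) = \<phi> a + \<phi> b \<and> \<phi> (ma_scale c a) = scale c (\<phi> a) \<and> \<phi> (ma_mult a b) = m (\<phi> a) (\<phi> b)"
    for a b c
  proof -
    obtain p q where "a = abs_free_ma p" "b = abs_free_ma q"
      by (metis Quotient3_abs_rep Quotient3_free_ma)
    then show ?thesis
      by (simp add: plus_free_ma.abs_eq ma_scale.abs_eq ma_mult.abs_eq \<phi>_abs \<Phi>_add \<Phi>_scale \<Phi>_mult)
  qed
  then have hom: "algebra_hom ma_scale ma_mult scale m \<phi>"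
    unfolding algebra_hom_def by (auto intro!: Vector_Spaces.linear.intro module_hom.intro
        module_hom_axioms.intro ma.vector_space_axioms B.vector_space_axioms
        ma.module_axioms B.module_axioms)
  have gen: "\<phi> (ma_gen x) = f x" for x
    by (simp add: ma_gen.abs_eq \<phi>_abs \<Phi>_single)
  have uniq: "\<psi> = \<phi>"
    if hom\<psi>: "algebra_hom ma_scale ma_mult scale m \<psi>" and gen\<psi>: "\<forall>x. \<psi> (ma_gen x) = f x" for \<psi>
  proof -
    interpret \<psi>: Vector_Spaces.linear ma_scale scale \<psi>
      using hom\<psi> by (simp add: algebra_hom_def)
    have \<psi>_mult: "\<psi> (ma_mult a b) = m (\<psi> a) (\<psi> b)" for a b
      using hom\<psi> by (simp add: algebra_hom_def)
    have tree: "\<psi> (abs_free_ma (Poly_Mapping.single t 1)) = ev t" for t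
    proof (induction t)
      case (Leaf x)
      then show ?case using gen\<psi> by (simp add: ma_gen.abs_eq)
    next
      case (Node l r)
      have "abs_free_ma (Poly_Mapping.single (Node l r) 1)
          = ma_mult (abs_free_ma (Poly_Mapping.single l (1::'k))) (abs_free_ma (Poly_Mapping.single r 1))"
        by (simp add: ma_mult.abs_eq fna_mult_single)
      then show ?case by (simp add: \<psi>_mult Node.IH)
    qed
    have mono: "\<psi> (abs_free_ma (Poly_Mapping.single t c)) = scale c (ev t)" for t c
    proof -
      have "Poly_Mapping.single t c = fna_scale c (Poly_Mapping.single t 1)"
        by (rule poly_mapping_eqI) (simp add: lookup_fna_scale lookup_single when_def)
      then have "abs_free_ma (Poly_Mapping.single t c)
          = ma_scale c (abs_free_ma (Poly_Mapping.single t 1))"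
        by (simp add: ma_scale.abs_eq)
      then show ?thesis by (simp add: \<psi>.scale tree)
    qed
    have abs0: "\<psi> (abs_free_ma 0) = 0"
      using \<psi>.zero by (simp add: zero_free_ma.abs_eq)
    have "\<psi> (abs_free_ma p) = \<Phi> p" for p
    proof (induction p rule: update_induct)
      case const
      then show ?case by (simp add: abs0 \<Phi>.zero)
    next
      case (update p t c)
      have "Poly_Mapping.update t c p = p + Poly_Mapping.single t c"
        using update.hyps by (intro poly_mapping_eqI)
          (auto simp: lookup_update lookup_add lookup_single when_def in_keys_iff)
      moreover have "abs_free_ma (p + Poly_Mapping.single t c)
          = abs_free_ma p + abs_free_ma (Poly_Mapping.single t c)"
        by (simp add: plus_free_ma.abs_eq)
      ultimately show ?case
        by (simp add: \<psi>.add update.IH mono \<Phi>_add \<Phi>_single)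
    qed
    then show ?thesis
      by (metis (no_types) Quotient3_abs_rep Quotient3_free_ma \<phi>_abs ext)
  qed
  show ?thesis
    using hom gen uniq by blast
qed


section \<open>Linear automorphisms and the general linear group\<close>

definition linear_Aut :: "(('k::field, 'x) free_ma \<Rightarrow> ('k, 'x) free_ma) monoid" where
  "linear_Aut = (Aut ma_scale ma_mult)
     \<lparr>carrier := {\<phi> \<in> carrier (Aut ma_scale ma_mult). \<forall>i. \<phi> (ma_gen i) \<in> ma.span (range ma_gen)}\<rparr>"

definition GL :: "('k::field ^ 'n ^ 'n) monoid" where
  "GL = \<lparr>carrier = {M. invertible M}, mult = (**), one = mat 1\<rparr>"

lemma group_GL: "group (GL :: ('k::field ^ 'n ^ 'n) monoid)"
proof (rule groupI)
  show "A \<otimes>\<^bsub>GL\<^esub> B \<in> carrier GL" if "A \<in> carrier GL" "B \<in> carrier GL" for A B :: "'k ^ 'n ^ 'n"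
    using that by (simp add: GL_def invertible_mult)
  show "\<exists>B\<in>carrier GL. B \<otimes>\<^bsub>GL\<^esub> A = \<one>\<^bsub>GL\<^esub>" if "A \<in> carrier GL" for A :: "'k ^ 'n ^ 'n"
    using that by (auto simp: GL_def invertible_def)
qed (auto simp: GL_def matrix_mul_assoc invertible_def intro!: exI[of _ "mat 1"])

end

theory Submission
  imports Defs
begin

text \<open>
  The square of the rank two free algebra \<open>A\<close> is a free right module of rank one, generated by
  \<open>x\<^sub>1x\<^sub>2\<close>, over the free associative algebra \<open>F\<close> in two letters \<open>y\<^sub>1, y\<^sub>2\<close>, where \<open>y\<^sub>i\<close> acts by right
  multiplication by \<open>x\<^sub>i\<close>. An automorphism sends \<open>x\<^sub>i\<close> to \<open>l\<^sub>i + f\<^sub>i\<close> with independent linear forms \<open>l\<^sub>i\<close>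
  and \<open>f\<^sub>i\<close> in \<open>F\<close>, so it sends \<open>x\<^sub>1x\<^sub>2\<close> to \<open>p = det (l\<^sub>1, l\<^sub>2) + f\<^sub>1l\<^sub>2 - f\<^sub>2l\<^sub>1\<close> and the square of \<open>A\<close> onto
  \<open>pF\<close>. Hence \<open>pF = F\<close>, which forces \<open>p\<close> to be a scalar by degree; then \<open>f\<^sub>1l\<^sub>2 = f\<^sub>2l\<^sub>1\<close>, and \<open>f\<^sub>1 = f\<^sub>2 = 0\<close>
  because \<open>l\<^sub>1, l\<^sub>2\<close> freely generate a left ideal of \<open>F\<close>.
\<close>

section \<open>Homomorphisms of algebras and the universal property\<close>

lemma algebra_hom_iff:
  assumes "nonassoc_algebra s m" "nonassoc_algebra s' m'"
  shows "algebra_hom s m s' m' f \<longleftrightarrow>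
    (\<forall>a b. f (a + b) = f a + f b) \<and> (\<forall>c a. f (s c a) = s' c (f a)) \<and> (\<forall>a b. f (m a b) = m' (f a) (f b))"
  using assms unfolding algebra_hom_def Vector_Spaces.linear_iff nonassoc_algebra_def by blast

lemma algebra_hom_id:
  assumes "nonassoc_algebra s m"
  shows "algebra_hom s m s m (\<lambda>x. x)"
  by (simp add: algebra_hom_iff assms)

lemma algebra_hom_comp:
  assumes "algebra_hom s m s' m' f" "algebra_hom s' m' s'' m'' g"
  shows "algebra_hom s m s'' m'' (\<lambda>x. g (f x))"
  using assms unfolding algebra_hom_def Vector_Spaces.linear_iff by auto

lemma algebra_hom_sum_scale:
  assumes "algebra_hom s m s' m' f"
  shows "f (\<Sum>i\<in>I. s (c i) (a i)) = (\<Sum>i\<in>I. s' (c i) (f (a i)))"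
proof -
  interpret f: Vector_Spaces.linear s s' f using assms by (simp add: algebra_hom_def)
  show ?thesis by (simp add: f.sum f.scale)
qed

text \<open>This is the uniqueness half of the universal property, with the free algebra itself as
  target.\<close>

lemma ma_hom_ext:
  fixes f g :: "('k::field, 'x) free_ma \<Rightarrow> ('k, 'x) free_ma"
  assumes "algebra_hom ma_scale ma_mult ma_scale ma_mult f"
    and "algebra_hom ma_scale ma_mult ma_scale ma_mult g"
    and "\<And>x. f (ma_gen x) = g (ma_gen x)"
  shows "f = g"
  using free_ma_universal[OF ma.nonassoc_algebra_axioms ma_anticommutative ma_metabelian,
      of "\<lambda>x. g (ma_gen x)"] assms by blast


section \<open>Linear automorphisms and matrices\<close>

lemma nonassoc_algebra_trivial_mult:
  "nonassoc_algebra (*s) (\<lambda>_ _. 0 :: 'k::field ^ 'n)"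
  by unfold_locales (auto simp: vec_eq_iff algebra_simps)

text \<open>The quotient by the square of the algebra, obtained as the homomorphism to \<open>K\<^sup>n\<close> with zero
  multiplication.\<close>

definition lin_part :: "('k::field, 'n::finite) free_ma \<Rightarrow> 'k ^ 'n" where
  "lin_part = (THE \<phi>. algebra_hom ma_scale ma_mult (*s) (\<lambda>_ _. 0) \<phi> \<and> (\<forall>i. \<phi> (ma_gen i) = axis i 1))"

lemma
  shows algebra_hom_lin_part:
      "algebra_hom ma_scale ma_mult (*s) (\<lambda>_ _. 0) (lin_part :: ('k::field, 'n::finite) free_ma \<Rightarrow> 'k ^ 'n)"
    and lin_part_gen: "lin_part (ma_gen i) = (axis i 1 :: 'k ^ 'n)"
proof -
  have "\<exists>!\<phi> :: ('k, 'n) free_ma \<Rightarrow> 'k ^ 'n.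
      algebra_hom ma_scale ma_mult (*s) (\<lambda>_ _. 0) \<phi> \<and> (\<forall>i. \<phi> (ma_gen i) = axis i 1)"
    by (rule free_ma_universal[OF nonassoc_algebra_trivial_mult])
       (auto simp: anticommutative_def metabelian_def)
  from theI'[OF this, folded lin_part_def]
  show "algebra_hom ma_scale ma_mult (*s) (\<lambda>_ _. 0) (lin_part :: ('k, 'n) free_ma \<Rightarrow> _)"
    and "lin_part (ma_gen i) = (axis i 1 :: 'k ^ 'n)" by blast+
qed

section \<open>Linear combinations of the generators\<close>

definition gen_comb :: "'k ^ 'n \<Rightarrow> ('k::field, 'n::finite) free_ma" where
  "gen_comb v = (\<Sum>i\<in>UNIV. ma_scale (v $ i) (ma_gen i))"

lemma gen_comb_add: "gen_comb (u + v) = gen_comb u + gen_comb v"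
  by (simp add: gen_comb_def ma.scale_left_distrib sum.distrib)

lemma gen_comb_scale: "gen_comb (c *s v) = ma_scale c (gen_comb v)"
  by (simp add: gen_comb_def ma.scale_sum_right)

lemma gen_comb_0 [simp]: "gen_comb 0 = 0"
  by (simp add: gen_comb_def)

lemma gen_comb_axis [simp]: "gen_comb (axis i 1) = ma_gen i"
proof -
  have "gen_comb (axis i 1) = (\<Sum>j\<in>UNIV. if j = i then ma_gen i else 0)"
    unfolding gen_comb_def by (intro sum.cong) (auto simp: axis_def)
  then show ?thesis by simp
qed

lemma lin_part_gen_comb [simp]: "lin_part (gen_comb v) = v"
proof -
  have "lin_part (gen_comb v) = (\<Sum>i\<in>UNIV. v $ i *s axis i 1)"
    unfolding gen_comb_def algebra_hom_sum_scale[OF algebra_hom_lin_part] by (simp add: lin_part_gen)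
  then show ?thesis by (simp add: basis_expansion)
qed

lemma gen_comb_in_span: "gen_comb v \<in> ma.span (range ma_gen)"
  unfolding gen_comb_def by (intro ma.span_sum ma.span_scale ma.span_base) simp

lemma span_gen_eq: "ma.span (range ma_gen) = range gen_comb"
proof
  show "ma.span (range ma_gen) \<subseteq> range gen_comb"
  proof (rule ma.span_minimal)
    show "range ma_gen \<subseteq> range gen_comb"
      by (metis gen_comb_axis image_subsetI rangeI)
    show "ma.subspace (range gen_comb)"
      unfolding ma.subspace_def
      by (auto simp: gen_comb_add[symmetric] gen_comb_scale[symmetric] intro: range_eqI[of _ _ 0])
  qed
qed (auto intro: gen_comb_in_span)

text \<open>The images of the generators give the columns, so that composition becomes the matrix
  product in the same order.\<close>

definition aut_matrix :: "(('k::field, 'n::finite) free_ma \<Rightarrow> ('k, 'n) free_ma) \<Rightarrow> 'k ^ 'n ^ 'n" where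
  "aut_matrix \<phi> = (\<chi> i j. lin_part (\<phi> (ma_gen j)) $ i)"

lemma aut_matrix_id: "aut_matrix (\<lambda>x. x) = mat 1"
  by (auto simp: aut_matrix_def lin_part_gen vec_eq_iff mat_def axis_def)

lemma gen_comb_aut_matrix_column:
  assumes "\<phi> (ma_gen j) \<in> ma.span (range ma_gen)"
  shows "\<phi> (ma_gen j) = gen_comb (\<chi> i. aut_matrix \<phi> $ i $ j)"
proof -
  obtain v where v: "\<phi> (ma_gen j) = gen_comb v" using assms unfolding span_gen_eq by blast
  then have "(\<chi> i. aut_matrix \<phi> $ i $ j) = v" by (simp add: aut_matrix_def vec_eq_iff)
  then show ?thesis using v by simp
qed

text \<open>The images under \<open>\<psi>\<close> are combinations of generators; expand them and
  push the sums through the linear maps \<open>\<phi>\<close> and \<open>lin_part\<close>.\<close>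

lemma aut_matrix_comp:
  fixes \<phi> \<psi> :: "('k::field, 'n::finite) free_ma \<Rightarrow> ('k, 'n) free_ma"
  assumes hom: "algebra_hom ma_scale ma_mult ma_scale ma_mult \<phi>"
    and span: "\<And>j. \<psi> (ma_gen j) \<in> ma.span (range ma_gen)"
  shows "aut_matrix (\<lambda>x. \<phi> (\<psi> x)) = aut_matrix \<phi> ** aut_matrix \<psi>"
proof -
  have "lin_part (\<phi> (\<psi> (ma_gen j))) = (\<Sum>k\<in>UNIV. (aut_matrix \<psi> $ k $ j) *s lin_part (\<phi> (ma_gen k)))" for j
    by (subst gen_comb_aut_matrix_column[of \<psi>, OF span])
       (simp add: gen_comb_def algebra_hom_sum_scale[OF hom] algebra_hom_sum_scale[OF algebra_hom_lin_part])
  then show ?thesis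
    by (simp add: vec_eq_iff aut_matrix_def[of "\<lambda>x. \<phi> (\<psi> x)"] matrix_matrix_mult_def sum_component mult.commute)
       (simp add: aut_matrix_def mult.commute)
qed

lemma linear_Aut_iff:
  "\<phi> \<in> carrier linear_Aut \<longleftrightarrow> algebra_hom ma_scale ma_mult ma_scale ma_mult \<phi> \<and> bij \<phi> \<and>
    (\<forall>i. \<phi> (ma_gen i) \<in> ma.span (range ma_gen))"
  by (simp add: linear_Aut_def Aut_def)

lemma ex_hom_aut_matrix:
  fixes M :: "'k::field ^ 'n ^ 'n"
  obtains \<phi> where "algebra_hom ma_scale ma_mult ma_scale ma_mult \<phi>"
    "\<And>j. \<phi> (ma_gen j) \<in> ma.span (range ma_gen)" "aut_matrix \<phi> = M"
proof -
  obtain \<phi> where \<phi>: "algebra_hom ma_scale ma_mult ma_scale ma_mult \<phi>"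
    "\<And>j. \<phi> (ma_gen j) = gen_comb (\<chi> i. M $ i $ j)"
    using free_ma_universal[OF ma.nonassoc_algebra_axioms ma_anticommutative ma_metabelian,
        of "\<lambda>j. gen_comb (\<chi> i. M $ i $ j)"] by blast
  have "aut_matrix \<phi> = M" by (simp add: aut_matrix_def \<phi>(2) vec_eq_iff)
  then show ?thesis using that \<phi> gen_comb_in_span by metis
qed

lemma hom_eqI_aut_matrix:
  assumes "algebra_hom ma_scale ma_mult ma_scale ma_mult \<phi>"
    and "algebra_hom ma_scale ma_mult ma_scale ma_mult \<psi>"
    and "\<And>j. \<phi> (ma_gen j) \<in> ma.span (range ma_gen)" "\<And>j. \<psi> (ma_gen j) \<in> ma.span (range ma_gen)"
    and "aut_matrix \<phi> = aut_matrix \<psi>"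
  shows "\<phi> = \<psi>"
proof (rule ma_hom_ext[OF assms(1,2)])
  show "\<phi> (ma_gen j) = \<psi> (ma_gen j)" for j
    using gen_comb_aut_matrix_column[of \<phi> j, OF assms(3)] gen_comb_aut_matrix_column[of \<psi> j, OF assms(4)]
      assms(5) by simp
qed

text \<open>The composite and the identity are homomorphisms with linear images of the generators
  and the same matrix, so they agree.\<close>

lemma hom_inverse_aut_matrix:
  fixes \<phi> \<psi> :: "('k::field, 'n::finite) free_ma \<Rightarrow> ('k, 'n) free_ma"
  assumes "algebra_hom ma_scale ma_mult ma_scale ma_mult \<phi>"
    and "algebra_hom ma_scale ma_mult ma_scale ma_mult \<psi>"
    and "\<And>j. \<psi> (ma_gen j) \<in> ma.span (range ma_gen)"
    and "\<And>j. \<phi> (ma_gen j) \<in> ma.span (range ma_gen)"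
    and "aut_matrix \<phi> ** aut_matrix \<psi> = mat 1"
  shows "\<phi> (\<psi> x) = x"
proof -
  have "\<phi> (\<psi> (ma_gen j)) \<in> ma.span (range ma_gen)" for j
  proof -
    have "\<phi> (\<psi> (ma_gen j)) = (\<Sum>k\<in>UNIV. ma_scale (aut_matrix \<psi> $ k $ j) (\<phi> (ma_gen k)))"
      by (subst gen_comb_aut_matrix_column[of \<psi>, OF assms(3)])
         (simp add: gen_comb_def algebra_hom_sum_scale[OF assms(1)])
    then show ?thesis using assms(4) by (simp add: ma.span_sum ma.span_scale)
  qed
  then have "(\<lambda>x. \<phi> (\<psi> x)) = (\<lambda>x. x)"
    using assms by (intro hom_eqI_aut_matrix)
      (auto simp: aut_matrix_comp aut_matrix_id ma.span_base algebra_hom_comp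
        intro: algebra_hom_id ma.nonassoc_algebra_axioms)
  then show ?thesis by meson
qed

text \<open>Injectivity holds because a linear endomorphism is determined by its matrix. For
  surjectivity, a matrix and its inverse both lift to endomorphisms, and the lifts are mutually
  inverse.\<close>

theorem linear_Aut_iso_GL:
  "(linear_Aut :: (('k::field, 'n::finite) free_ma \<Rightarrow> ('k, 'n) free_ma) monoid) \<cong> (GL :: ('k ^ 'n ^ 'n) monoid)"
proof (rule is_isoI[OF isoI])
  let ?L = "linear_Aut :: (('k, 'n) free_ma \<Rightarrow> ('k, 'n) free_ma) monoid"
  have inv: "invertible (aut_matrix \<phi>)" if \<phi>: "\<phi> \<in> carrier ?L" for \<phi>
  proof -
    have "bij \<phi>" using \<phi> by (simp add: linear_Aut_iff)
    define \<psi> where "\<psi> = inv_into UNIV \<phi>"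
    have \<psi>\<phi>: "\<psi> (\<phi> x) = x" and \<phi>\<psi>: "\<phi> (\<psi> x) = x" for x
      using \<open>bij \<phi>\<close> by (simp_all add: \<psi>_def bij_is_inj bij_is_surj surj_f_inv_f)
    have hom: "algebra_hom ma_scale ma_mult ma_scale ma_mult \<phi>" using \<phi> by (simp add: linear_Aut_iff)
    have hom': "algebra_hom ma_scale ma_mult ma_scale ma_mult \<psi>"
      using hom \<psi>\<phi> \<phi>\<psi> unfolding algebra_hom_iff[OF ma.nonassoc_algebra_axioms ma.nonassoc_algebra_axioms]
      by metis
    have "aut_matrix \<psi> ** aut_matrix \<phi> = mat 1"
      using \<phi> by (subst aut_matrix_comp[symmetric, OF hom']) (simp_all add: linear_Aut_iff \<psi>\<phi> aut_matrix_id)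
    then show ?thesis by (meson invertible_def matrix_left_right_inverse)
  qed
  show "aut_matrix \<in> hom ?L GL"
    using inv by (auto simp: hom_def GL_def linear_Aut_iff o_def linear_Aut_def Aut_def intro!: aut_matrix_comp)
  show "bij_betw aut_matrix (carrier ?L) (carrier GL)"
    unfolding bij_betw_def
  proof
    show "inj_on aut_matrix (carrier ?L)"
      by (auto simp: inj_on_def linear_Aut_iff intro!: hom_eqI_aut_matrix)
    show "aut_matrix ` carrier ?L = carrier GL"
    proof
      show "aut_matrix ` carrier ?L \<subseteq> carrier GL" using inv by (auto simp: GL_def)
      show "carrier GL \<subseteq> aut_matrix ` carrier ?L"
      proof
        fix M :: "'k ^ 'n ^ 'n" assume "M \<in> carrier GL"
        then obtain N where N: "M ** N = mat 1" "N ** M = mat 1" by (auto simp: GL_def invertible_def)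
        obtain \<phi> \<psi> where \<phi>: "algebra_hom ma_scale ma_mult ma_scale ma_mult \<phi>"
            "\<And>j. \<phi> (ma_gen j) \<in> ma.span (range ma_gen)" "aut_matrix \<phi> = M"
          and \<psi>: "algebra_hom ma_scale ma_mult ma_scale ma_mult \<psi>"
            "\<And>j. \<psi> (ma_gen j) \<in> ma.span (range ma_gen)" "aut_matrix \<psi> = N"
          using ex_hom_aut_matrix by metis
        have "\<phi> (\<psi> x) = x" "\<psi> (\<phi> x) = x" for x
          using \<phi> \<psi> N by (simp_all add: hom_inverse_aut_matrix)
        then have "bij \<phi>" by (rule_tac o_bij[of \<psi>]) auto
        then show "M \<in> aut_matrix ` carrier ?L"
          using \<phi> by (auto simp: linear_Aut_iff)
      qed
    qed
  qed
qed

section \<open>The free algebra of rank two in coordinates\<close>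

lift_definition pm_scale :: "'k::field \<Rightarrow> ('w \<Rightarrow>\<^sub>0 'k) \<Rightarrow> ('w \<Rightarrow>\<^sub>0 'k)"
  is "\<lambda>c p t. c * p t"
  by (erule rev_finite_subset) auto

lemma lookup_pm_scale [simp]: "Poly_Mapping.lookup (pm_scale c p) t = c * Poly_Mapping.lookup p t"
  by (simp add: pm_scale.rep_eq)

lemma pm_scale_single: "pm_scale c (Poly_Mapping.single t a) = Poly_Mapping.single t (c * a)"
  by (rule poly_mapping_eqI) (simp add: lookup_single when_def)

lemma pm_scale_simps:
  "pm_scale c 0 = 0" "pm_scale 0 p = 0" "pm_scale 1 p = p"
  "pm_scale c (pm_scale d p) = pm_scale (c * d) p"
  "pm_scale (c + d) p = pm_scale c p + pm_scale d p" "pm_scale c (p + q) = pm_scale c p + pm_scale c q"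
  by (rule poly_mapping_eqI; simp add: lookup_add algebra_simps)+

lemma poly_mapping_single_induct [case_names zero add]:
  assumes "P 0" and "\<And>p t c. P p \<Longrightarrow> P (p + Poly_Mapping.single t c)"
  shows "P p"
proof (induction p rule: update_induct)
  case (update p t c)
  have "Poly_Mapping.update t c p = p + Poly_Mapping.single t c"
    using update.hyps by (intro poly_mapping_eqI)
      (auto simp: lookup_update lookup_add lookup_single when_def in_keys_iff)
  then show ?case using assms(2) update.IH by simp
qed (fact assms(1))

text \<open>A list of indices stands for the monomial with its letters in reverse order, so that right
  multiplication by the generator \<open>i\<close> is \<^term>\<open>Cons i\<close>; \<open>word_act f v\<close> is the product of \<open>f\<close> with the
  linear form \<open>v\<close> in the free associative algebra.\<close>

lift_definition word_act :: "('n list \<Rightarrow>\<^sub>0 'k::field) \<Rightarrow> 'k ^ 'n::finite \<Rightarrow> ('n list \<Rightarrow>\<^sub>0 'k)"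
  is "\<lambda>f v w. case w of [] \<Rightarrow> 0 | i # w' \<Rightarrow> f w' * v $ i"
proof -
  fix f :: "'n list \<Rightarrow> 'k" and v :: "'k ^ 'n"
  assume "finite {w. f w \<noteq> 0}"
  then have "finite ((\<lambda>(i, w). i # w) ` (UNIV \<times> {w. f w \<noteq> 0}))" by simp
  moreover have "{w. (case w of [] \<Rightarrow> 0 | i # w' \<Rightarrow> f w' * v $ i) \<noteq> 0}
      \<subseteq> (\<lambda>(i, w). i # w) ` (UNIV \<times> {w. f w \<noteq> 0})"
    by (auto simp: image_iff neq_Nil_conv split: list.splits)
  ultimately show "finite {w. (case w of [] \<Rightarrow> 0 | i # w' \<Rightarrow> f w' * v $ i) \<noteq> 0}"
    by (rule rev_finite_subset)
qed

lemma lookup_word_act [simp]: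
  "Poly_Mapping.lookup (word_act f v) [] = 0"
  "Poly_Mapping.lookup (word_act f v) (i # w) = Poly_Mapping.lookup f w * v $ i"
  by (simp_all add: word_act.rep_eq)

lemma word_poly_eqI:
  assumes "Poly_Mapping.lookup f [] = Poly_Mapping.lookup g []"
    and "\<And>i w. Poly_Mapping.lookup f (i # w) = Poly_Mapping.lookup g (i # w)"
  shows "f = g"
  by (rule poly_mapping_eqI) (metis assms list.exhaust)

lemma word_act_linear:
  "word_act (f + g) v = word_act f v + word_act g v"
  "word_act f (u + v) = word_act f u + word_act f v"
  "word_act (pm_scale c f) v = pm_scale c (word_act f v)"
  "word_act f (c *s v) = pm_scale c (word_act f v)"
  "word_act 0 v = 0" "word_act f 0 = 0"
  by (rule word_poly_eqI; simp add: lookup_add algebra_simps)+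

lemma word_act_single_axis:
  "word_act (Poly_Mapping.single w c) (axis i 1) = Poly_Mapping.single (i # w) c"
  by (rule word_poly_eqI) (auto simp: lookup_single axis_def when_def)

text \<open>The determinant of two linear forms: the coefficient of
  \<open>x\<^sub>1x\<^sub>2\<close> in their product.\<close>

definition wedge :: "'k::field ^ 2 \<Rightarrow> 'k ^ 2 \<Rightarrow> 'k" where
  "wedge u v = u $ 1 * v $ 2 - u $ 2 * v $ 1"

lemma wedge_linear:
  "wedge (u + v) w = wedge u w + wedge v w" "wedge w (u + v) = wedge w u + wedge w v"
  "wedge (c *s u) w = c * wedge u w" "wedge u (c *s w) = c * wedge u w"
  "wedge u u = 0" "wedge 0 u = 0" "wedge u 0 = 0"
  by (simp_all add: wedge_def algebra_simps)

lemma wedge_axis: "wedge (axis 1 1) (axis 2 1) = 1"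
  by (simp add: wedge_def axis_def)

text \<open>A pair holds the linear part of an element and its component in the square of the
  algebra.\<close>

type_synonym 'k ma2 = "('k ^ 2) \<times> (2 list \<Rightarrow>\<^sub>0 'k)"

definition ma2_scale :: "'k::field \<Rightarrow> 'k ma2 \<Rightarrow> 'k ma2" where
  "ma2_scale c a = (c *s fst a, pm_scale c (snd a))"

text \<open>The square of the free algebra is a free module of rank one over the free associative
  algebra: the generator \<open>x\<^sub>1x\<^sub>2\<close> corresponds to the empty word.\<close>

definition ma2_mult :: "'k::field ma2 \<Rightarrow> 'k ma2 \<Rightarrow> 'k ma2" where
  "ma2_mult a b = (0, Poly_Mapping.single [] (wedge (fst a) (fst b))
     + word_act (snd a) (fst b) - word_act (snd b) (fst a))"

lemma ma2_algebra: "nonassoc_algebra ma2_scale ma2_mult"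
  by unfold_locales
    (auto simp: ma2_scale_def ma2_mult_def prod_eq_iff vec_eq_iff wedge_linear word_act_linear
      algebra_simps lookup_add lookup_minus lookup_single when_def intro!: poly_mapping_eqI)

lemma ma2_anticommutative: "anticommutative ma2_mult"
  by (simp add: anticommutative_def ma2_mult_def wedge_linear prod_eq_iff)

text \<open>Products have linear part zero, and every term of \<open>ma2_mult\<close> contains the
  linear part of a factor.\<close>

lemma ma2_metabelian: "metabelian ma2_mult"
  by (simp add: metabelian_def ma2_mult_def wedge_linear word_act_linear prod_eq_iff)

section \<open>Left-normed monomials starting with \<open>x\<^sub>1x\<^sub>2\<close> and their
  combinations\<close>

definition ma_word :: "2 list \<Rightarrow> ('k::field, 2) free_ma" where
  "ma_word w = foldr (\<lambda>i a. ma_mult a (ma_gen i)) w (ma_mult (ma_gen 1) (ma_gen 2))"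

lemma ma_word_simps:
  "ma_word [] = ma_mult (ma_gen 1) (ma_gen 2)"
  "ma_word (i # w) = ma_mult (ma_word w) (ma_gen i)"
  by (simp_all add: ma_word_def)

definition word_comb :: "(2 list \<Rightarrow>\<^sub>0 'k) \<Rightarrow> ('k::field, 2) free_ma" where
  "word_comb f = (\<Sum>w\<in>Poly_Mapping.keys f. ma_scale (Poly_Mapping.lookup f w) (ma_word w))"

lemma word_comb_eq:
  assumes "finite S" "Poly_Mapping.keys f \<subseteq> S"
  shows "word_comb f = (\<Sum>w\<in>S. ma_scale (Poly_Mapping.lookup f w) (ma_word w))"
  unfolding word_comb_def using assms by (intro sum.mono_neutral_left) (auto simp: in_keys_iff)

lemma word_comb_add: "word_comb (f + g) = word_comb f + word_comb g"
  using keys_add[of f g]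
  by (simp add: word_comb_eq[of "Poly_Mapping.keys f \<union> Poly_Mapping.keys g"] lookup_add
      ma.scale_left_distrib sum.distrib)

lemma word_comb_scale: "word_comb (pm_scale c f) = ma_scale c (word_comb f)"
proof -
  have "Poly_Mapping.keys (pm_scale c f) \<subseteq> Poly_Mapping.keys f" by (auto simp: in_keys_iff)
  then show ?thesis by (simp add: word_comb_eq[of "Poly_Mapping.keys f"] ma.scale_sum_right)
qed

lemma word_comb_single: "word_comb (Poly_Mapping.single w c) = ma_scale c (ma_word w)"
  using word_comb_eq[of "{w}" "Poly_Mapping.single w c"] by simp

lemma word_comb_0: "word_comb 0 = 0"
  by (simp add: word_comb_def)

lemma word_comb_minus: "word_comb (f - g) = word_comb f - word_comb g"
  by (metis add_diff_cancel_right' diff_add_cancel word_comb_add)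

section \<open>Multiplication of normal forms\<close>

lemma ma_mult_0 [simp]: "ma_mult 0 a = 0" "ma_mult a 0 = 0"
  using ma.amult_add_left[of 0 0 a] ma.amult_add_right[of a 0 0] by simp_all

lemma ma_mult_sum_right: "ma_mult a (sum g S) = (\<Sum>s\<in>S. ma_mult a (g s))"
  by (induction S rule: infinite_finite_induct) (simp_all add: ma.amult_add_right)

lemma ma_mult_self: "ma_mult a a = 0"
  using ma_anticommutative unfolding anticommutative_def by blast

lemma ma_mult_products: "ma_mult (ma_mult a b) (ma_mult c d) = 0"
  using ma_metabelian unfolding metabelian_def by blast

lemma ma_mult_swap: "ma_mult a b = - ma_mult b a"
proof -
  have "ma_mult (a + b) (a + b) = ma_mult a b + ma_mult b a"
    unfolding ma.amult_add_left ma.amult_add_right by (simp add: ma_mult_self)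
  then show ?thesis by (simp add: ma_mult_self eq_neg_iff_add_eq_0)
qed

lemma word_comb_act: "word_comb (word_act f v) = ma_mult (word_comb f) (gen_comb v)"
proof (induction f rule: poly_mapping_single_induct)
  case (add f w c)
  have "word_act (Poly_Mapping.single w c) v = (\<Sum>i\<in>UNIV. Poly_Mapping.single (i # w) (c * v $ i))"
    by (rule word_poly_eqI) (use exhaust_2 in \<open>auto simp: lookup_add lookup_single when_def UNIV_2\<close>)
  then have "word_comb (word_act (Poly_Mapping.single w c) v)
      = (\<Sum>i\<in>UNIV. ma_scale (c * v $ i) (ma_mult (ma_word w) (ma_gen i)))"
    by (simp add: UNIV_2 word_comb_add word_comb_single ma_word_simps)
  also have "\<dots> = ma_mult (ma_scale c (ma_word w)) (gen_comb v)"
    by (simp add: gen_comb_def ma_mult_sum_right ma.amult_scale_left ma.amult_scale_right ma.scale_sum_right mult.commute)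
  finally show ?case
    using add by (simp add: word_act_linear word_comb_add ma.amult_add_left word_comb_single)
qed (simp add: word_act_linear word_comb_0)

lemma word_comb_mult_word_comb: "ma_mult (word_comb f) (word_comb g) = 0"
proof -
  \<comment> \<open>Every \<open>ma_word\<close> is itself a product, so the metabelian identity
    applies.\<close>
  have mult_word: "ma_mult (ma_word w) (ma_word w') = 0" for w w'
    by (cases w; cases w') (simp_all add: ma_word_simps ma_mult_products)
  have "ma_mult (ma_word w) (word_comb g) = 0" for w
    by (induction g rule: poly_mapping_single_induct)
      (simp_all add: word_comb_0 word_comb_add word_comb_single ma.amult_add_right ma.amult_scale_right mult_word)
  then show ?thesis
    by (induction f rule: poly_mapping_single_induct)
      (simp_all add: word_comb_0 word_comb_add word_comb_single ma.amult_add_left ma.amult_scale_left)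
qed

lemma gen_comb_mult_gen_comb:
  fixes u v :: "'k::field ^ 2"
  shows "ma_mult (gen_comb u) (gen_comb v) = ma_scale (wedge u v) (ma_word [])"
proof -
  have sw: "ma_mult (ma_gen 2) (ma_gen 1) = - (ma_word [] :: ('k, 2) free_ma)"
    unfolding ma_word_simps by (rule ma_mult_swap)
  show ?thesis
    by (simp add: gen_comb_def UNIV_2 ma.amult_add_left ma.amult_add_right ma.amult_scale_left
        ma.amult_scale_right ma_mult_self sw ma_word_simps(1)[symmetric] wedge_def ma.scale_left_diff_distrib mult.commute)
qed

definition of_ma2 :: "'k::field ma2 \<Rightarrow> ('k, 2) free_ma" where
  "of_ma2 a = gen_comb (fst a) + word_comb (snd a)"

lemma algebra_hom_of_ma2:
  "algebra_hom ma2_scale ma2_mult ma_scale ma_mult (of_ma2 :: 'k::field ma2 \<Rightarrow> ('k, 2) free_ma)"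
  unfolding algebra_hom_iff[OF ma2_algebra ma.nonassoc_algebra_axioms]
proof (intro conjI allI)
  fix a b :: "'k ma2" and c :: 'k
  show "of_ma2 (a + b) = of_ma2 a + of_ma2 b"
    by (simp add: of_ma2_def gen_comb_add word_comb_add)
  show "of_ma2 (ma2_scale c a) = ma_scale c (of_ma2 a)"
    by (simp add: of_ma2_def ma2_scale_def gen_comb_scale word_comb_scale ma.scale_right_distrib)
  have "ma_mult (of_ma2 a) (of_ma2 b) = ma_scale (wedge (fst a) (fst b)) (ma_word [])
      + ma_mult (word_comb (snd a)) (gen_comb (fst b)) + ma_mult (gen_comb (fst a)) (word_comb (snd b))"
    by (simp add: of_ma2_def ma.amult_add_left ma.amult_add_right gen_comb_mult_gen_comb word_comb_mult_word_comb)
  then show "of_ma2 (ma2_mult a b) = ma_mult (of_ma2 a) (of_ma2 b)"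
    \<comment> \<open>Anticommutativity turns left multiplication by a linear form into right
      multiplication; this is the minus sign in \<open>ma2_mult\<close>.\<close>
    by (subst (asm) ma_mult_swap[of "gen_comb (fst a)"])
       (simp add: of_ma2_def ma2_mult_def word_comb_minus word_comb_add word_comb_single word_comb_act)
qed

lemma of_ma2_gen: "of_ma2 (axis i 1, 0) = ma_gen i"
  by (simp add: of_ma2_def word_comb_0)

text \<open>The map \<open>\<pi>\<close> comes from the universal property. One composite fixes the
  generators of the free algebra; the other is computed directly on linear parts and words, since
  freeness of \<open>ma2\<close> is what is being established.\<close>

lemma of_ma2_inverse:
  obtains \<pi> :: "('k::field, 2) free_ma \<Rightarrow> 'k ma2"
  where "algebra_hom ma_scale ma_mult ma2_scale ma2_mult \<pi>"
    "\<And>a. of_ma2 (\<pi> a) = a" "\<And>a. \<pi> (of_ma2 a) = a"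
proof -
  obtain \<pi> :: "('k, 2) free_ma \<Rightarrow> 'k ma2"
    where hom: "algebra_hom ma_scale ma_mult ma2_scale ma2_mult \<pi>"
      and gen: "\<And>i. \<pi> (ma_gen i) = (axis i 1, 0)"
    using free_ma_universal[OF ma2_algebra ma2_anticommutative ma2_metabelian, of "\<lambda>i. (axis i 1, 0)"]
    by blast
  have \<pi>: "\<pi> (a + b) = \<pi> a + \<pi> b" "\<pi> (ma_scale c a) = ma2_scale c (\<pi> a)"
    "\<pi> (ma_mult a b) = ma2_mult (\<pi> a) (\<pi> b)" for a b c
    using hom unfolding algebra_hom_iff[OF ma.nonassoc_algebra_axioms ma2_algebra] by blast+
  have "(\<lambda>a. of_ma2 (\<pi> a)) = (\<lambda>a. a)"
    by (rule ma_hom_ext)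
      (auto intro!: algebra_hom_comp[OF hom] algebra_hom_of_ma2 algebra_hom_id ma.nonassoc_algebra_axioms
        simp: gen of_ma2_gen)
  then have 1: "of_ma2 (\<pi> a) = a" for a by meson
  have word: "\<pi> (ma_word w) = (0, Poly_Mapping.single w 1)" for w
    by (induction w)
      (simp_all add: ma_word_simps \<pi> gen ma2_mult_def wedge_axis word_act_linear wedge_linear
        word_act_single_axis)
  have 0: "\<pi> 0 = 0" using \<pi>(1)[of 0 0] by simp
  have comb: "\<pi> (word_comb f) = (0, f)" for f
    by (induction f rule: poly_mapping_single_induct)
      (simp_all add: word_comb_0 word_comb_add word_comb_single 0 \<pi> word ma2_scale_def pm_scale_single zero_prod_def)
  have "\<pi> (gen_comb v) = (v, 0)" for v
  proof -
    have "\<pi> (gen_comb v) = (\<Sum>i\<in>UNIV. ma2_scale (v $ i) (axis i 1, 0))"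
      unfolding gen_comb_def algebra_hom_sum_scale[OF hom] gen ..
    then show ?thesis
      by (auto simp: UNIV_2 ma2_scale_def prod_eq_iff vec_eq_iff axis_def forall_2 pm_scale_simps)
  qed
  then have "\<pi> (of_ma2 a) = a" for a by (simp add: of_ma2_def \<pi> comb)
  then show ?thesis using that hom 1 by blast
qed


section \<open>Automorphisms are linear\<close>

text \<open>The right ideal generated by \<open>p\<close> over the subalgebra generated by the linear forms
  \<open>u\<close> and \<open>v\<close>.\<close>

inductive_set word_ideal :: "(2 list \<Rightarrow>\<^sub>0 'k::field) \<Rightarrow> 'k ^ 2 \<Rightarrow> 'k ^ 2 \<Rightarrow> (2 list \<Rightarrow>\<^sub>0 'k) set"
  for p u v where
  zero: "0 \<in> word_ideal p u v"
| step: "\<lbrakk>g \<in> word_ideal p u v; h \<in> word_ideal p u v\<rbrakk>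
    \<Longrightarrow> pm_scale c p + word_act g u + word_act h v \<in> word_ideal p u v"

text \<open>Two elements built by \<open>step\<close> are added component by component, and the
  induction hypotheses cover the sums of the components.\<close>

lemma word_ideal_add:
  assumes "m \<in> word_ideal p u v" "m' \<in> word_ideal p u v"
  shows "m + m' \<in> word_ideal p u v"
  using assms
proof (induction arbitrary: m')
  case (step g h c)
  from step.prems show ?case
  proof cases
    case zero
    then show ?thesis using word_ideal.step[OF step.hyps] by simp
  next
    case (step g' h' c')
    have "pm_scale (c + c') p + word_act (g + g') u + word_act (h + h') v \<in> word_ideal p u v"
      using step by (intro word_ideal.step step.IH)
    then show ?thesis using step by (simp add: word_act_linear pm_scale_simps algebra_simps)
  qed
qed simp

lemma word_ideal_scale:
  assumes "m \<in> word_ideal p u v"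
  shows "pm_scale d m \<in> word_ideal p u v"
  using assms
proof induction
  case (step g h c)
  have "pm_scale (d * c) p + word_act (pm_scale d g) u + word_act (pm_scale d h) v \<in> word_ideal p u v"
    by (intro word_ideal.step step.IH)
  then show ?case by (simp add: word_act_linear pm_scale_simps)
qed (simp add: pm_scale_simps word_ideal.zero)

lemma word_ideal_gen: "p \<in> word_ideal p u v"
  using word_ideal.step[OF word_ideal.zero word_ideal.zero, of 1]
  by (simp add: word_act_linear pm_scale_simps)

lemma word_ideal_act:
  assumes "m \<in> word_ideal p u v"
  shows "word_act m u \<in> word_ideal p u v" "word_act m v \<in> word_ideal p u v"
  using word_ideal.step[OF assms word_ideal.zero, of 0] word_ideal.step[OF word_ideal.zero assms, of 0]
  by (simp_all add: word_act_linear pm_scale_simps)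

section \<open>Independent linear forms and degrees\<close>

lemma wedge_nonzero_solve:
  assumes "wedge u v \<noteq> 0" "\<And>i. a * u $ i + b * v $ i = 0"
  shows "a = 0" "b = 0"
proof -
  \<comment> \<open>Cramer's rule: eliminate one unknown from the two equations.\<close>
  have "a * wedge u v = (a * u $ 1 + b * v $ 1) * v $ 2 - (a * u $ 2 + b * v $ 2) * v $ 1"
    "b * wedge u v = (a * u $ 2 + b * v $ 2) * u $ 1 - (a * u $ 1 + b * v $ 1) * u $ 2"
    by (simp_all add: wedge_def algebra_simps)
  then have "a * wedge u v = 0" "b * wedge u v = 0" unfolding assms(2) by simp_all
  then show "a = 0" "b = 0" using assms(1) by simp_all
qed

text \<open>The coefficients at \<open>i # w\<close> are a combination of \<open>u $ i\<close> and
  \<open>v $ i\<close> whose weights are the coefficients of \<open>g\<close> and \<open>h\<close>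
  at \<open>w\<close>; independence keeps them from vanishing for both \<open>i\<close>.\<close>

lemma word_act_nonzero:
  assumes "wedge u v \<noteq> 0" "Poly_Mapping.lookup g w \<noteq> 0 \<or> Poly_Mapping.lookup h w \<noteq> 0"
  shows "\<exists>i. Poly_Mapping.lookup (word_act g u + word_act h v) (i # w) \<noteq> 0"
  using wedge_nonzero_solve[OF assms(1), of "Poly_Mapping.lookup g w" "Poly_Mapping.lookup h w"] assms(2)
  by (auto simp: lookup_add)

text \<open>Multiplying by independent linear forms raises the degree, so an element of the right ideal
  that is not a scalar multiple of \<open>p\<close> has larger degree than \<open>p\<close>.\<close>

lemma word_ideal_degree:
  assumes uv: "wedge u v \<noteq> 0"
    and top: "Poly_Mapping.lookup p w0 \<noteq> 0" "\<And>w. Poly_Mapping.lookup p w \<noteq> 0 \<Longrightarrow> length w \<le> length w0"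
    and m: "m \<in> word_ideal p u v"
  shows "(\<exists>c. m = pm_scale c p) \<or> (\<exists>w. Poly_Mapping.lookup m w \<noteq> 0 \<and> length w > length w0)"
  using m
proof induction
  case zero
  show ?case by (metis pm_scale_simps(2))
next
  \<comment> \<open>By induction a nonzero \<open>g\<close> or \<open>h\<close> has a word at least
    as long as \<open>w0\<close>. One more letter makes it longer than every word of
    \<open>p\<close>, so the scalar multiple of \<open>p\<close> cannot cancel it.\<close>
  case (step g h c)
  have key: "\<exists>w. Poly_Mapping.lookup f w \<noteq> 0 \<and> length w \<ge> length w0"
    if "f \<noteq> 0" "(\<exists>c. f = pm_scale c p) \<or> (\<exists>w. Poly_Mapping.lookup f w \<noteq> 0 \<and> length w > length w0)" for f
    using that(2)
  proof
    assume "\<exists>c. f = pm_scale c p"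
    then obtain d where "f = pm_scale d p" by blast
    then have "Poly_Mapping.lookup f w0 \<noteq> 0" using that(1) top(1) by (auto simp: pm_scale_simps)
    then show ?thesis by blast
  qed (use less_imp_le in blast)
  show ?case
  proof (cases "g = 0 \<and> h = 0")
    case True
    then show ?thesis by (auto simp: word_act_linear)
  next
    case False
    then obtain w where w: "Poly_Mapping.lookup g w \<noteq> 0 \<or> Poly_Mapping.lookup h w \<noteq> 0" "length w \<ge> length w0"
      using key[of g] key[of h] step.IH by blast
    obtain i where i: "Poly_Mapping.lookup (word_act g u + word_act h v) (i # w) \<noteq> 0"
      using word_act_nonzero[OF uv w(1)] by blast
    have "Poly_Mapping.lookup p (i # w) = 0" using top(2)[of "i # w"] w(2) by force
    then have "Poly_Mapping.lookup (pm_scale c p + word_act g u + word_act h v) (i # w) \<noteq> 0"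
      using i by (simp add: lookup_add)
    moreover have "length (i # w) > length w0" using w(2) by simp
    ultimately show ?thesis by blast
  qed
qed

text \<open>The empty word is never longer than \<open>w0\<close>, so the degree alternative leaves
  only that the unit is a scalar multiple of \<open>p\<close>.\<close>

lemma word_ideal_unit:
  assumes uv: "wedge u v \<noteq> 0" and one: "Poly_Mapping.single [] 1 \<in> word_ideal p u v"
  obtains c where "p = Poly_Mapping.single [] c"
proof (cases "p = 0")
  case True
  then show ?thesis using that[of 0] by simp
next
  case False
  let ?K = "Poly_Mapping.keys p"
  have "?K \<noteq> {}" using False by simp
  then have "Max (length ` ?K) \<in> length ` ?K" by simp
  then obtain w0 where "w0 \<in> ?K" "Max (length ` ?K) = length w0" by (rule imageE)
  then have w0: "w0 \<in> ?K" "\<And>w. w \<in> ?K \<Longrightarrow> length w \<le> length w0"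
    by (metis, metis Max_ge finite_imageI finite_keys imageI)
  obtain c where c: "Poly_Mapping.single [] 1 = pm_scale c p"
    using word_ideal_degree[OF uv _ _ one, of w0] w0
    by (auto simp: in_keys_iff lookup_single when_def split: if_splits)
  have "c \<noteq> 0"
    using arg_cong[OF c, of "\<lambda>q. Poly_Mapping.lookup q []"] by auto
  then have "p = pm_scale (inverse c) (pm_scale c p)" by (simp add: pm_scale_simps)
  then have "p = Poly_Mapping.single [] (inverse c)" by (simp add: c[symmetric] pm_scale_single)
  then show ?thesis by (rule that)
qed

section \<open>Surjective endomorphisms of the coordinate algebra\<close>

lemma ma2_aut_linear:
  fixes \<psi> :: "'k::field ma2 \<Rightarrow> 'k ma2"
  assumes hom: "algebra_hom ma2_scale ma2_mult ma2_scale ma2_mult \<psi>" and surj: "surj \<psi>"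
  shows "snd (\<psi> (axis i 1, 0)) = 0"
proof -
  have \<psi>: "\<psi> (a + b) = \<psi> a + \<psi> b" "\<psi> (ma2_scale c a) = ma2_scale c (\<psi> a)"
    "\<psi> (ma2_mult a b) = ma2_mult (\<psi> a) (\<psi> b)" for a b c
    using hom unfolding algebra_hom_iff[OF ma2_algebra ma2_algebra] by blast+
  have \<psi>0: "\<psi> 0 = 0" using \<psi>(1)[of 0 0] by simp
  define l where "l j = fst (\<psi> (axis j 1, 0))" for j
  define f where "f j = snd (\<psi> (axis j 1, 0))" for j
  have \<psi>_gen: "\<psi> (axis j 1, 0) = (l j, f j)" for j by (simp add: l_def f_def)
  define p where "p = Poly_Mapping.single [] (wedge (l 1) (l 2)) + word_act (f 1) (l 2) - word_act (f 2) (l 1)"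
  let ?M = "word_ideal p (l 1) (l 2)"
  have word: "\<exists>m\<in>?M. \<psi> (0, Poly_Mapping.single w 1) = (0, m)" for w
  proof (induction w)
    case Nil
    have "(0, Poly_Mapping.single [] 1) = ma2_mult (axis 1 1, 0) (axis 2 1, 0 :: 2 list \<Rightarrow>\<^sub>0 'k)"
      by (simp add: ma2_mult_def word_act_linear wedge_axis)
    then have "\<psi> (0, Poly_Mapping.single [] 1) = (0, p)"
      by (simp add: \<psi> \<psi>_gen) (simp add: ma2_mult_def p_def)
    then show ?case using word_ideal_gen by blast
  next
    case (Cons i w)
    then obtain m where m: "m \<in> ?M" "\<psi> (0, Poly_Mapping.single w 1) = (0, m)" by blast
    have "(0, Poly_Mapping.single (i # w) 1) = ma2_mult (0, Poly_Mapping.single w 1) (axis i 1, 0 :: 2 list \<Rightarrow>\<^sub>0 'k)"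
      by (simp add: ma2_mult_def word_act_linear wedge_linear word_act_single_axis)
    then have "\<psi> (0, Poly_Mapping.single (i # w) 1) = (0, word_act m (l i))"
      by (simp add: \<psi> \<psi>_gen m) (simp add: ma2_mult_def word_act_linear wedge_linear)
    moreover have "word_act m (l i) \<in> ?M" using word_ideal_act[OF m(1)] exhaust_2[of i] by auto
    ultimately show ?case by blast
  qed
  have square: "\<exists>m\<in>?M. \<psi> (0, g) = (0, m)" for g
  proof (induction g rule: poly_mapping_single_induct)
    case zero
    then show ?case using \<psi>0 word_ideal.zero by (auto simp: zero_prod_def)
  next
    case (add g w c)
    then obtain m m' where "m \<in> ?M" "\<psi> (0, g) = (0, m)"
      "m' \<in> ?M" "\<psi> (0, Poly_Mapping.single w 1) = (0, m')" using word by blast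
    moreover have "(0, g + Poly_Mapping.single w c) = (0, g) + ma2_scale c (0, Poly_Mapping.single w 1)"
      by (simp add: ma2_scale_def pm_scale_single)
    ultimately have "\<psi> (0, g + Poly_Mapping.single w c) = (0, m + pm_scale c m')"
      by (simp add: \<psi>) (simp add: ma2_scale_def)
    then show ?case using \<open>m \<in> ?M\<close> \<open>m' \<in> ?M\<close> by (blast intro: word_ideal_add word_ideal_scale)
  qed
  \<comment> \<open>The square is mapped into itself, so \<open>g\<close> does not affect the linear
    part of the image.\<close>
  have fst_\<psi>: "fst (\<psi> (v, g)) = v $ 1 *s l 1 + v $ 2 *s l 2" for v g
  proof -
    have "(v, g) = ma2_scale (v $ 1) (axis 1 1, 0) + ma2_scale (v $ 2) (axis 2 1, 0) + (0, g)"
      by (auto simp: ma2_scale_def vec_eq_iff axis_def forall_2 pm_scale_simps)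
    moreover have "fst (\<psi> (0, g)) = 0" using square[of g] by auto
    ultimately show ?thesis by (simp add: \<psi> \<psi>_gen) (simp add: ma2_scale_def)
  qed
  have wedge: "wedge (l 1) (l 2) \<noteq> 0"
  proof
    assume *: "wedge (l 1) (l 2) = 0"
    have "wedge (l 2) (l 1) = - wedge (l 1) (l 2)" by (simp add: wedge_def)
    \<comment> \<open>Dependent \<open>l 1\<close> and \<open>l 2\<close> would make the linear
      parts of any two images dependent, but both generators are images.\<close>
    then have "wedge (v $ 1 *s l 1 + v $ 2 *s l 2) (w $ 1 *s l 1 + w $ 2 *s l 2) = 0" for v w :: "'k ^ 2"
      using * by (simp add: wedge_linear)
    then have "wedge (fst (\<psi> a)) (fst (\<psi> b)) = 0" for a b
      by (cases a; cases b) (simp add: fst_\<psi>)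
    moreover obtain a b where "\<psi> a = (axis 1 1, 0)" "\<psi> b = (axis 2 1, 0)" using surj by (metis surjD)
    ultimately have "wedge (axis 1 1) (axis 2 1 :: 'k ^ 2) = 0" by (metis fst_conv)
    then show False by (simp add: wedge_axis)
  qed
  \<comment> \<open>A preimage of \<open>x\<^sub>1x\<^sub>2\<close> has linear part zero by
    independence, so it lies in the square and the unit lies in the right ideal of
    \<open>p\<close>.\<close>
  obtain v g where vg: "\<psi> (v, g) = (0, Poly_Mapping.single [] 1)" using surj by (metis surjD surj_pair)
  then have "v $ 1 *s l 1 + v $ 2 *s l 2 = 0" using fst_\<psi>[of v g] by simp
  then have "v $ 1 * l 1 $ j + v $ 2 * l 2 $ j = 0" for j by (simp add: vec_eq_iff)
  from wedge_nonzero_solve[OF wedge this] have "v = 0" by (simp add: vec_eq_iff forall_2)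
  then have "Poly_Mapping.single [] 1 \<in> ?M" using vg square[of g] by auto
  from word_ideal_unit[OF wedge this] obtain c where c: "p = Poly_Mapping.single [] c" by blast
  have "Poly_Mapping.lookup (f 1) w = 0 \<and> Poly_Mapping.lookup (f 2) w = 0" for w
  proof -
    \<comment> \<open>The scalar \<open>p\<close> has coefficient zero at the nonempty word
      \<open>j # w\<close>, where \<open>p_def\<close> gives exactly this expression.\<close>
    have "- Poly_Mapping.lookup (f 2) w * l 1 $ j + Poly_Mapping.lookup (f 1) w * l 2 $ j = 0" for j
      using arg_cong[OF c, of "\<lambda>q. Poly_Mapping.lookup q (j # w)"]
      by (simp add: p_def lookup_add lookup_minus lookup_single)
    from wedge_nonzero_solve[OF wedge this] show ?thesis by simp
  qed
  then show ?thesis using exhaust_2[of i] by (auto simp: f_def intro!: poly_mapping_eqI)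
qed

text \<open>Conjugating by the isomorphism \<open>of_ma2\<close> reduces this to the coordinate
  algebra.\<close>

lemma hom_gen_in_span:
  fixes \<phi> :: "('k::field, 2) free_ma \<Rightarrow> ('k, 2) free_ma"
  assumes hom: "algebra_hom ma_scale ma_mult ma_scale ma_mult \<phi>" and surj: "surj \<phi>"
  shows "\<phi> (ma_gen i) \<in> ma.span (range ma_gen)"
proof -
  obtain \<pi> :: "('k, 2) free_ma \<Rightarrow> 'k ma2" where \<pi>: "algebra_hom ma_scale ma_mult ma2_scale ma2_mult \<pi>"
    "\<And>a. of_ma2 (\<pi> a) = a" "\<And>a. \<pi> (of_ma2 a) = a" by (rule of_ma2_inverse) blast
  let ?\<psi> = "\<lambda>a. \<pi> (\<phi> (of_ma2 a))"
  have "algebra_hom ma2_scale ma2_mult ma2_scale ma2_mult ?\<psi>"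
    by (rule algebra_hom_comp[OF algebra_hom_comp[OF algebra_hom_of_ma2 hom] \<pi>(1)])
  moreover have "surj ?\<psi>"
  unfolding surj_def proof
    fix y
    obtain a where "\<phi> a = of_ma2 y" using surj by (metis surjD)
    then show "\<exists>x. y = ?\<psi> x" by (intro exI[of _ "\<pi> a"]) (simp add: \<pi>)
  qed
  ultimately have 0: "snd (?\<psi> (axis i 1, 0)) = 0" by (rule ma2_aut_linear)
  then have "\<phi> (ma_gen i) = gen_comb (fst (\<pi> (\<phi> (ma_gen i))))"
    using \<pi>(2)[of "\<phi> (ma_gen i)"] 0 unfolding of_ma2_gen of_ma2_def[of "\<pi> _"] by (simp add: word_comb_0)
  then show ?thesis by (metis gen_comb_in_span)
qed

theorem lemma6:
  shows "Aut (ma_scale :: 'k::field \<Rightarrow> ('k, 2) free_ma \<Rightarrow> ('k, 2) free_ma) ma_mult = linear_Aut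
    \<and> Aut (ma_scale :: 'k \<Rightarrow> ('k, 2) free_ma \<Rightarrow> ('k, 2) free_ma) ma_mult \<cong> (GL :: ('k ^ 2 ^ 2) monoid)"
proof -
  have eq: "Aut (ma_scale :: 'k \<Rightarrow> ('k, 2) free_ma \<Rightarrow> ('k, 2) free_ma) ma_mult = linear_Aut"
    by (auto simp: linear_Aut_def Aut_def intro!: hom_gen_in_span dest: bij_is_surj)
  then show ?thesis using linear_Aut_iso_GL by simp
qed

end
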